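(* Suppose that $X$ and $Y$ are Polish spaces and $f \colon X \to Y$ is a Baire-class one function. Then exactly one of the following holds: (1) The function $f$ is $F_\sigma$-to-one. (2) There is a topological embedding of $f_0$ into $f$.
   Context: A subset of a topological space is $F_\sigma$ if it is a union of countably-many closed sets. A function between topological spaces is Baire class one if preimages of open sets are $F_\sigma$, and $F_\sigma$-to-one if the preimage of each singleton is $F_\sigma$. Let $\mathbb{N}^{<\mathbb{N}}$ be the set of finite sequences of natural numbers, $\mathbb{N}^{\mathbb{N}}$ the set of infinite sequences of natural numbers, and $\mathbb{N}^{\le\mathbb{N}} = \mathbb{N}^{<\mathbb{N}} \cup \mathbb{N}^{\mathbb{N}}$. Write $s \sqsubseteq t$ if $t$ extends $s$. For $s \in \mathbb{N}^{<\mathbb{N}}$ put $\mathcal{N}_s^* = \{t \in \mathbb{N}^{\le\mathbb{N}} \mid s \sqsubseteq t\}$. Let $\mathbb{N}^{\le\mathbb{N}}_*$ denote the set $\mathbb{N}^{\le\mathbb{N}}$ equipped with the smallest topology making the sets $\mathcal{N}_s^*$ clopen for all $s \in \mathbb{N}^{<\mathbb{N}}$. Fix a function $f_0 \colon \mathbb{N}^{\le\mathbb{N}}_* \to \mathbb{R}$ such that $f_0 \upharpoonright \mathbb{N}^{\mathbb{N}}$ has constant value $0$ and $f_0 \upharpoonright \mathbb{N}^{<\mathbb{N}}$ is an injection into $\{1/n \mid n \in \mathbb{N},\ n \ge 1\}$. A topological embedding of a topological space $X$ into a topological space $Y$ is a function $\pi \colon X \to Y$ which is a homeomorphism onto its image,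 where the image carries the subspace topology. A topological embedding of a function $f \colon X \to Y$ into a function $f' \colon X' \to Y'$ is a pair $(\pi_X, \pi_Y)$ consisting of topological embeddings $\pi_X$ of $X$ into $X'$ and $\pi_Y$ of $f(X)$ into $f'(X')$ (with the subspace topologies) such that $f' \circ \pi_X = \pi_Y \circ f$. *)

theory Defs
  imports "HOL-Analysis.Analysis" "HOL-Library.Sublist"
begin

definition Polish_space :: "'a topology \<Rightarrow> bool" where
  "Polish_space X \<longleftrightarrow> completely_metrizable_space X \<and> separable_space X"

definition baire_class_one :: "'a topology \<Rightarrow> 'b topology \<Rightarrow> ('a \<Rightarrow> 'b) \<Rightarrow> bool" where
  "baire_class_one X Y f \<longleftrightarrow>
     f \<in> topspace X \<rightarrow> topspace Y \<and>
     (\<forall>U. openin Y U \<longrightarrow> fsigma_in X {x \<in> topspace X. f x \<in> U})"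

definition fsigma_to_one :: "'a topology \<Rightarrow> 'b topology \<Rightarrow> ('a \<Rightarrow> 'b) \<Rightarrow> bool" where
  "fsigma_to_one X Y f \<longleftrightarrow>
     (\<forall>y \<in> topspace Y. fsigma_in X {x \<in> topspace X. f x = y})"

datatype nat_seq = FinSeq "nat list" | InfSeq "nat \<Rightarrow> nat"

fun extended_by :: "nat list \<Rightarrow> nat_seq \<Rightarrow> bool" where
  "extended_by s (FinSeq t) \<longleftrightarrow> prefix s t"
| "extended_by s (InfSeq x) \<longleftrightarrow> (\<forall>i < length s. s ! i = x i)"

definition N_star :: "nat list \<Rightarrow> nat_seq set" where
  "N_star s = {t. extended_by s t}"

definition nat_seq_topology :: "nat_seq topology" where
  "nat_seq_topology = topology_generated_by (range N_star \<union> range (\<lambda>s. - N_star s))"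

lemma N_star_Nil [simp]: "N_star [] = UNIV"
proof -
  have "extended_by [] t" for t
    by (cases t) auto
  then show ?thesis
    by (auto simp: N_star_def)
qed

lemma topspace_nat_seq_topology [simp]: "topspace nat_seq_topology = UNIV"
  unfolding nat_seq_topology_def topology_generated_by_topspace by auto

lemma N_star_clopen:
  "openin nat_seq_topology (N_star s)" "closedin nat_seq_topology (N_star s)"
  by (auto simp: closedin_def Compl_eq_Diff_UNIV [symmetric])
     (auto simp: nat_seq_topology_def intro!: topology_generated_by_Basis)

lemma nat_seq_topology_smallest:
  assumes "topspace T = UNIV"
    and "\<And>s. openin T (N_star s) \<and> closedin T (N_star s)"
    and "openin nat_seq_topology U"
  shows "openin T U"
proof -
  have "generate_topology_on (range N_star \<union> range (\<lambda>s. - N_star s)) U"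
    using assms(3) unfolding nat_seq_topology_def by (rule openin_topology_generated_by)
  then show ?thesis
    by induction (use assms(1,2) in \<open>auto simp: closedin_def Compl_eq_Diff_UNIV\<close>)
qed

definition function_embedding ::
  "'a topology \<Rightarrow> 'b topology \<Rightarrow> ('a \<Rightarrow> 'b) \<Rightarrow>
   'c topology \<Rightarrow> 'd topology \<Rightarrow> ('c \<Rightarrow> 'd) \<Rightarrow> ('a \<Rightarrow> 'c) \<Rightarrow> ('b \<Rightarrow> 'd) \<Rightarrow> bool" where
  "function_embedding X Y f X' Y' f' \<pi>X \<pi>Y \<longleftrightarrow>
     embedding_map X X' \<pi>X \<and>
     embedding_map (subtopology Y (f ` topspace X)) (subtopology Y' (f' ` topspace X')) \<pi>Y \<and>
     (\<forall>x \<in> topspace X. f' (\<pi>X x) = \<pi>Y (f x))"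

end

theory Submission
  imports Defs
begin

text \<open>
  The two alternatives exclude each other because the infinite sequences do not form an \<open>F\<^sub>\<sigma>\<close>
  set in \<^const>\<open>nat_seq_topology\<close> (\<open>not_fsigma_in_range_InfSeq\<close>), although they form a fibre of \<open>f\<^sub>0\<close>.
  An embedding of \<open>f\<^sub>0\<close> into \<open>f\<close> pulls a fibre of \<open>f\<close> back to exactly this set.

  For existence, suppose that \<open>A = f\<^sup>-\<^sup>1(y)\<close> is not \<open>F\<^sub>\<sigma>\<close>. As \<open>f\<close> is of the first class, \<open>A\<close> is
  \<open>G\<^sub>\<delta>\<close>. Discarding every open set on which \<open>A\<close> is \<open>F\<^sub>\<sigma>\<close> leaves a nonempty closed set \<open>F\<close> such that
  \<open>A \<inter> U \<inter> F\<close> fails to be \<open>F\<^sub>\<sigma>\<close> for every open \<open>U\<close> meeting \<open>F\<close> (\<open>nowhere_fsigma_kernel\<close>).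
  Two consequences hold for such \<open>U\<close>. First, \<open>U \<inter> F\<close> contains a point of \<open>A\<close>. Second, for every
  ball \<open>B\<close> around \<open>y\<close> it contains a point outside \<open>A\<close> with value in \<open>B\<close>: otherwise
  \<open>A \<inter> U \<inter> F\<close> would coincide with \<open>f\<^sup>-\<^sup>1(B) \<inter> U \<inter> F\<close>, which is \<open>F\<^sub>\<sigma>\<close> since \<open>f\<close> is of the first class.
  This is how the Baire class of \<open>f\<close> controls the values of \<open>f\<close> off the fibre.

  These two density properties drive a construction in the style of Hurewicz
  (\<open>ball_scheme_exists\<close>): each finite sequence \<open>s\<close> gets a ball and a point \<open>x\<^sub>s \<in> F - A\<close> in it.
  The balls of the successors of \<open>s\<close> are disjoint, are centred in \<open>A \<inter> F\<close>, converge to \<open>x\<^sub>s\<close>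
  and avoid it, and shrink into the open sets whose intersection is \<open>A\<close>. The values
  \<open>f x\<^sub>s\<close> are chosen along an enumeration of the finite sequences, each strictly closer to \<open>y\<close> than
  all earlier ones, with distances tending to \<open>0\<close>. By completeness every branch of the scheme has a limit, which lies in \<open>A\<close>, and
  sending \<open>s\<close> to \<open>x\<^sub>s\<close> and a branch to its limit is a topological embedding
  (\<open>embedding_of_ball_scheme\<close>).

  On the range side, both \<open>f\<^sub>0(s)\<close> and \<open>f(x\<^sub>s)\<close> are injectively indexed points converging to one
  further point. The topology of such a set is determined by its limit point and the cofinite
  sets, so matching the points is an embedding (\<open>embedding_map_convergent_set\<close>).
\<close>

section \<open>The space of finite and infinite sequences\<close>

lemma FinSeq_in_N_star [simp]: "FinSeq t \<in> N_star s \<longleftrightarrow> prefix s t"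
  by (simp add: N_star_def)

lemma InfSeq_in_N_star: "InfSeq z \<in> N_star s \<longleftrightarrow> map z [0..<length s] = s"
proof -
  have "map z [0..<length s] = s \<longleftrightarrow> (\<forall>i<length s. z i = s ! i)"
    unfolding list_eq_iff_nth_eq by simp
  then show ?thesis by (auto simp: N_star_def)
qed

lemma InfSeq_in_N_star_restrict: "InfSeq z \<in> N_star (map z [0..<n])"
  by (simp add: InfSeq_in_N_star)

lemma FinSeq_notin_N_star_longer: "length s < length t \<Longrightarrow> FinSeq s \<notin> N_star t"
  using prefix_length_le by fastforce

lemma N_star_snoc_cases:
  assumes "t \<in> N_star s" "t \<noteq> FinSeq s"
  obtains k where "t \<in> N_star (s @ [k])"
proof (cases t)
  case (FinSeq u)
  then obtain v where u: "u = s @ v" "v \<noteq> []" using assms by (auto simp: prefix_def)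
  then have "u = (s @ [hd v]) @ tl v" by simp
  then show ?thesis using that FinSeq by (metis FinSeq_in_N_star prefixI)
next
  case (InfSeq z)
  then have "t \<in> N_star (s @ [z (length s)])" using assms by (auto simp: InfSeq_in_N_star)
  then show ?thesis by (rule that)
qed

lemma N_star_separates_points:
  assumes "t \<noteq> t'"
  obtains s where "t \<in> N_star s \<longleftrightarrow> t' \<notin> N_star s"
proof -
  have *: "\<exists>s. FinSeq u \<in> N_star s \<longleftrightarrow> InfSeq z \<notin> N_star s" for u z
    using InfSeq_in_N_star_restrict[of z "Suc (length u)"]
      FinSeq_notin_N_star_longer[of u "map z [0..<Suc (length u)]"] by fastforce
  have "\<exists>s. t \<in> N_star s \<longleftrightarrow> t' \<notin> N_star s"
  proof (cases t; cases t')
    fix u u' assume "t = FinSeq u" "t' = FinSeq u'"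
    with assms show ?thesis using prefix_order.antisym[of u u'] by (auto intro: exI[of _ u] exI[of _ u'])
  next
    fix z z' assume eq: "t = InfSeq z" "t' = InfSeq z'"
    with assms obtain i where "z i \<noteq> z' i" by auto
    then have "map z' [0..<Suc i] \<noteq> map z [0..<Suc i]" by simp
    then have "InfSeq z' \<notin> N_star (map z [0..<Suc i])"
      unfolding InfSeq_in_N_star by simp
    then show ?thesis using InfSeq_in_N_star_restrict[of z "Suc i"] eq by blast
  qed (use * in \<open>metis\<close>)+
  then show ?thesis using that by blast
qed

text \<open>
  This is the only local information about \<^const>\<open>nat_seq_topology\<close> that the diagonal argument
  below uses. It holds because a subbasic set \<open>N_star p\<close> or \<open>- N_star p\<close> around \<open>s\<close> can miss points
  above \<open>s @ [k]\<close> for at most one \<open>k\<close>, namely the entry of \<open>p\<close> at position \<open>length s\<close>.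
\<close>
lemma openin_FinSeq_tail:
  assumes "openin nat_seq_topology U" "FinSeq s \<in> U"
  obtains k where "N_star (s @ [k]) \<subseteq> U"
proof -
  have "generate_topology_on (range N_star \<union> range (\<lambda>s. - N_star s)) U"
    using assms(1) unfolding nat_seq_topology_def by (rule openin_topology_generated_by)
  \<comment> \<open>For the induction, "some \<open>k\<close>" is strengthened to "all large \<open>k\<close>", which survives intersections.\<close>
  then have "FinSeq s \<in> U \<Longrightarrow> \<exists>K. \<forall>k\<ge>K. N_star (s @ [k]) \<subseteq> U"
  proof (induction)
    case Empty
    then show ?case by simp
  next
    case (Int a b)
    then obtain K L where "\<forall>k\<ge>K. N_star (s @ [k]) \<subseteq> a" "\<forall>k\<ge>L. N_star (s @ [k]) \<subseteq> b" by auto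
    then show ?case by (intro exI[of _ "max K L"]) auto
  next
    case (UN \<K>)
    then show ?case by (meson UnionE Union_upper order_trans)
  next
    case (Basis V)
    have prefixes: "u \<in> N_star p \<Longrightarrow> prefix q p \<Longrightarrow> u \<in> N_star q" for u p q
      by (cases u) (auto simp: N_star_def prefix_def nth_append split: if_splits)
    consider p where "V = N_star p" | p where "V = - N_star p" using Basis by auto
    then show ?case
    proof cases
      case 1
      then show ?thesis using Basis prefixes
        by (metis FinSeq_in_N_star prefix_prefix subsetI)
    next
      case 2
      have "N_star (s @ [k]) \<inter> N_star p = {}" if "k \<ge> Suc (p ! length s)" for k
      proof (rule ccontr)
        assume "N_star (s @ [k]) \<inter> N_star p \<noteq> {}"
        then obtain t where t: "t \<in> N_star (s @ [k])" "t \<in> N_star p" by auto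
        have "prefix (s @ [k]) p \<or> prefix p (s @ [k])"
        proof (cases t)
          case (FinSeq u)
          then show ?thesis using t by (metis FinSeq_in_N_star prefix_same_cases)
        next
          case (InfSeq z)
          have restrict: "prefix (map z [0..<m]) (map z [0..<n])" if "m \<le> n" for m n
            using that take_is_prefix[of m "map z [0..<n]"] by (simp add: take_map)
          have "map z [0..<length (s @ [k])] = s @ [k]" "map z [0..<length p] = p"
            using t InfSeq InfSeq_in_N_star by blast+
          then show ?thesis using restrict by (metis linorder_le_cases)
        qed
        moreover have "\<not> prefix p s" using Basis 2 by simp
        ultimately have "prefix (s @ [k]) p" by auto
        then have "p ! length s = k" by (auto simp: prefix_def)
        with that show False by simp
      qed
      then show ?thesis using 2 by (intro exI[of _ "Suc (p ! length s)"]) blast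
    qed
  qed
  then show ?thesis using assms(2) that by blast
qed

text \<open>
  A diagonal argument: a closed set of infinite sequences omits each finite sequence together
  with a neighbourhood of it, so the current finite sequence can be extended by one entry such that
  everything above it misses the next closed set. The branch obtained lies in none of them.
\<close>
lemma not_fsigma_in_range_InfSeq: "\<not> fsigma_in nat_seq_topology (range InfSeq)"
proof
  assume "fsigma_in nat_seq_topology (range InfSeq)"
  then obtain C where C: "\<And>n::nat. closedin nat_seq_topology (C n)" "\<Union> (range C) = range InfSeq"
    unfolding fsigma_in_ascending by metis
  have "\<exists>k. N_star (s @ [k]) \<inter> C n = {}" for s n
  proof -
    have "openin nat_seq_topology (- C n)" using C(1)[of n] by (simp add: closedin_def Compl_eq_Diff_UNIV)
    moreover have "FinSeq s \<in> - C n" using C(2) by blast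
    ultimately show ?thesis by (metis openin_FinSeq_tail disjoint_eq_subset_Compl)
  qed
  then obtain K where K: "\<And>s n. N_star (s @ [K s n]) \<inter> C n = {}" by metis
  define p where "p = rec_nat [] (\<lambda>n s. s @ [K s n])"
  have p: "p 0 = []" "p (Suc n) = p n @ [K (p n) n]" for n by (auto simp: p_def)
  define z where "z n = K (p n) n" for n
  have "p n = map z [0..<n]" for n by (induction n) (auto simp: p z_def)
  then have "InfSeq z \<in> N_star (p n)" for n by (metis InfSeq_in_N_star_restrict)
  then have "InfSeq z \<notin> C n" for n using K[of "p n" n] p(2)[of n] by (metis disjoint_iff)
  then show False using C(2) by blast
qed

text \<open>
  The topology is the smallest one with clopen \<open>N_star s\<close>, hence it is coarser than the topology
  pulled back along \<open>p\<close>. This gives openness onto the image for free, and injectivity holds since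
  the sets \<open>N_star s\<close> separate points.
\<close>
lemma embedding_map_nat_seqI:
  assumes cont: "continuous_map nat_seq_topology X p"
    and op: "\<And>s. \<exists>V. openin X V \<and> p -` V = N_star s"
    and cl: "\<And>s. \<exists>C. closedin X C \<and> p -` C = N_star s"
  shows "embedding_map nat_seq_topology X p"
proof -
  have top: "p t \<in> topspace X" for t using cont by (auto simp: continuous_map_def)
  then have full: "p -` topspace X = UNIV" by auto
  let ?T = "pullback_topology UNIV p X"
  have opn: "openin ?T (N_star s)" for s using op[of s] by (auto simp: openin_pullback_topology)
  have "openin ?T (- N_star s)" for s
  proof -
    obtain C where "closedin X C" "p -` C = N_star s" using cl by blast
    then show ?thesis unfolding openin_pullback_topology
      by (intro exI[of _ "topspace X - C"]) (use top in auto)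
  qed
  with opn full have "openin ?T U" if "openin nat_seq_topology U" for U
    by (intro nat_seq_topology_smallest[OF _ _ that])
       (auto simp: topspace_pullback_topology closedin_def Compl_eq_Diff_UNIV)
  then have open_vimage: "\<exists>V. openin X V \<and> U = p -` V" if "openin nat_seq_topology U" for U
    using that by (auto simp: openin_pullback_topology)
  show ?thesis unfolding embedding_map_def
  proof (rule bijective_open_imp_homeomorphic_map)
    show "open_map nat_seq_topology (subtopology X (p ` topspace nat_seq_topology)) p"
      unfolding open_map_def openin_subtopology
    proof (intro allI impI)
      fix U assume "openin nat_seq_topology U"
      then obtain V where "openin X V" "U = p -` V" using open_vimage by blast
      then show "\<exists>T. openin X T \<and> p ` U = T \<inter> p ` topspace nat_seq_topology" by auto
    qed
    show "inj_on p (topspace nat_seq_topology)"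
    proof (rule inj_onI, rule ccontr)
      fix t t' assume "p t = p t'" "t \<noteq> t'"
      then show False by (metis N_star_separates_points op vimage_eq)
    qed
  qed (use top cont in \<open>auto simp: continuous_map_in_subtopology\<close>)
qed

section \<open>Sets converging to a point\<close>

text \<open>
  If every neighbourhood of \<open>p\<close> contains all but finitely many points of \<open>D\<close>, then the other points
  of \<open>D\<close> are isolated: separating \<open>q\<close> from \<open>p\<close> leaves only finitely many points near \<open>q\<close>. The
  subspace topology therefore depends on \<open>D\<close> and \<open>p\<close> alone, and any injection that preserves
  such a situation is an embedding.
\<close>
lemma openin_convergent_set_iff:
  assumes "Hausdorff_space T" "D \<subseteq> topspace T" "p \<in> D"
    and conv: "\<And>V. openin T V \<Longrightarrow> p \<in> V \<Longrightarrow> finite (D - V)"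
  shows "openin (subtopology T D) S \<longleftrightarrow> S \<subseteq> D \<and> (p \<in> S \<longrightarrow> finite (D - S))"
proof
  assume "openin (subtopology T D) S"
  then obtain V where V: "openin T V" "S = V \<inter> D" by (auto simp: openin_subtopology)
  then have "D - S = D - V" by blast
  then show "S \<subseteq> D \<and> (p \<in> S \<longrightarrow> finite (D - S))" using V conv by auto
next
  assume S: "S \<subseteq> D \<and> (p \<in> S \<longrightarrow> finite (D - S))"
  have cofin: "openin T (topspace T - A)" if "finite A" "A \<subseteq> D" for A
    using that assms by (meson Hausdorff_imp_t1_space closedin_def openin_diff openin_topspace order_trans t1_space_closedin_finite)
  show "openin (subtopology T D) S"
  proof (cases "p \<in> S")
    case True
    then have "openin T (topspace T - (D - S))" using S cofin by auto
    moreover have "S = (topspace T - (D - S)) \<inter> D" using S assms by auto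
    ultimately show ?thesis unfolding openin_subtopology by blast
  next
    case False
    have "\<exists>V. openin T V \<and> V \<inter> D = {q}" if "q \<in> S" for q
    proof -
      have "q \<noteq> p" "q \<in> topspace T" "p \<in> topspace T" using False that S assms by auto
      then obtain V W where VW: "openin T V" "openin T W" "q \<in> V" "p \<in> W" "disjnt V W"
        using assms(1) unfolding Hausdorff_space_def by metis
      then have "D \<inter> V - {q} \<subseteq> D - W" by (auto simp: disjnt_def)
      then have "finite (D \<inter> V - {q})" using conv VW finite_subset by blast
      then have "openin T (V \<inter> (topspace T - (D \<inter> V - {q})))"
        using cofin VW(1) by (intro openin_Int) auto
      moreover have "V \<inter> (topspace T - (D \<inter> V - {q})) \<inter> D = {q}"
        using VW that S assms(2) by auto
      ultimately show ?thesis by blast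
    qed
    then have "openin (subtopology T D) {q}" if "q \<in> S" for q
      using that unfolding openin_subtopology by metis
    then have "openin (subtopology T D) (\<Union>q\<in>S. {q})" by blast
    then show ?thesis by simp
  qed
qed

lemma embedding_map_convergent_set:
  assumes T: "Hausdorff_space T" "D \<subseteq> topspace T" "p \<in> D"
    and T': "Hausdorff_space T'" "g ` D \<subseteq> topspace T'"
    and conv: "\<And>V. openin T V \<Longrightarrow> p \<in> V \<Longrightarrow> finite (D - V)"
    and conv': "\<And>V. openin T' V \<Longrightarrow> g p \<in> V \<Longrightarrow> finite (g ` D - V)"
    and inj: "inj_on g D"
  shows "embedding_map (subtopology T D) T' g"
proof -
  have top: "topspace (subtopology T D) = D" "topspace (subtopology T' (g ` D)) = g ` D"
    using T T' by auto
  have "openin (subtopology T D) {x \<in> D. g x \<in> U} = openin (subtopology T' (g ` D)) U"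
    if "U \<subseteq> g ` D" for U
  proof -
    have img: "g ` (D - {x \<in> D. g x \<in> U}) = g ` D - U" by blast
    have "inj_on g (D - {x \<in> D. g x \<in> U})" using inj by (rule inj_on_subset) blast
    then have "finite (D - {x \<in> D. g x \<in> U}) \<longleftrightarrow> finite (g ` D - U)"
      unfolding img[symmetric] by (rule finite_image_iff[symmetric])
    moreover have "openin (subtopology T D) {x \<in> D. g x \<in> U} \<longleftrightarrow>
        {x \<in> D. g x \<in> U} \<subseteq> D \<and> (p \<in> {x \<in> D. g x \<in> U} \<longrightarrow> finite (D - {x \<in> D. g x \<in> U}))"
      by (rule openin_convergent_set_iff[OF T], rule conv, assumption+)
    moreover have "openin (subtopology T' (g ` D)) U \<longleftrightarrow>
        U \<subseteq> g ` D \<and> (g p \<in> U \<longrightarrow> finite (g ` D - U))"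
      by (rule openin_convergent_set_iff[OF T' imageI[OF T(3)]], rule conv', assumption+)
    ultimately show ?thesis
      using that T(3) by blast
  qed
  then show ?thesis
    unfolding embedding_map_def homeomorphic_map_def quotient_map_def top using inj by simp
qed

section \<open>Embeddings from schemes of balls\<close>

text \<open>
  A Lusin scheme with a marked point \<open>x s\<close> in each ball. The successor balls accumulate only at
  \<open>x s\<close>, just as the sets \<open>N_star (s @ [k])\<close> accumulate only at \<open>FinSeq s\<close>.
\<close>
definition (in Metric_space) ball_scheme ::
    "(nat list \<Rightarrow> 'a) \<Rightarrow> (nat list \<Rightarrow> real) \<Rightarrow> (nat list \<Rightarrow> 'a) \<Rightarrow> bool" where
  "ball_scheme a r x \<longleftrightarrow>
     (\<forall>s. x s \<in> mball (a s) (r s) \<and> r s \<le> inverse (Suc (length s))) \<and>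
     (\<forall>s k. mcball (a (s @ [k])) (r (s @ [k]))
        \<subseteq> mball (a s) (r s) \<inter> mball (x s) (inverse (Suc k)) - {x s}) \<and>
     (\<forall>s j k. j \<noteq> k \<longrightarrow>
        disjnt (mcball (a (s @ [j])) (r (s @ [j]))) (mcball (a (s @ [k])) (r (s @ [k]))))"

text \<open>
  The open and the closed ball at \<open>s\<close> have the same preimage \<open>N_star s\<close>: points above \<open>s\<close> land in
  the open ball by nesting, and all others land outside the closed ball, because they branch off
  into a disjoint ball or are a marked point below \<open>s\<close>. Continuity at a marked point comes from the
  convergence of the successor balls, and at a branch from the shrinking radii.
\<close>
lemma (in Metric_space) embedding_of_ball_scheme:
  assumes mcomplete and scheme: "ball_scheme a r x"
  obtains p where "embedding_map nat_seq_topology mtopology p"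
    and "\<And>s. p (FinSeq s) = x s"
    and "\<And>z n. p (InfSeq z) \<in> mcball (a (map z [0..<n])) (r (map z [0..<n]))"
proof -
  define B where "B s = mball (a s) (r s)" for s
  define C where "C s = mcball (a s) (r s)" for s
  have point: "x s \<in> B s" and small: "r s \<le> inverse (Suc (length s))"
    and nested: "C (s @ [k]) \<subseteq> B s" and conv: "C (s @ [k]) \<subseteq> mball (x s) (inverse (Suc k))"
    and avoid: "x s \<notin> C (s @ [k])" and disj: "j \<noteq> k \<Longrightarrow> disjnt (C (s @ [j])) (C (s @ [k]))"
    for s j k
    using scheme unfolding ball_scheme_def B_def C_def by blast+
  have BC: "B s \<subseteq> C s" for s by (auto simp: B_def C_def)
  have C_append: "C (s @ u) \<subseteq> C s" for s u
  proof (induction u rule: rev_induct)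
    case (snoc k u)
    then show ?case using nested[of "s @ u" k] BC[of "s @ u"] by auto
  qed simp
  have C_parallel: "disjnt (C s) (C t)" if "length s = length t" "s \<noteq> t" for s t
    using that
  proof (induction s arbitrary: t rule: rev_induct)
    case (snoc k s)
    then obtain t' j where t: "t = t' @ [j]" by (cases t rule: rev_cases) auto
    show ?case
    proof (cases "s = t'")
      case True
      then show ?thesis using snoc.prems t disj[of k j s] by auto
    next
      case False
      then have "disjnt (C s) (C t')" using snoc t by auto
      then show ?thesis using C_append[of s "[k]"] C_append[of t' "[j]"] t disjnt_subset1 disjnt_subset2
        by metis
    qed
  qed simp
  have "\<exists>q. \<forall>n. q \<in> C (map z [0..<n])" for z
  proof -
    define D where "D n = C (map z [0..<n])" for n
    have "\<forall>n. closedin mtopology (D n)" by (simp add: D_def C_def)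
    moreover have "\<forall>n. D n \<noteq> {}" using point BC unfolding D_def by blast
    moreover have "decseq D"
      by (rule decseq_SucI) (use C_append[of _ "[_]"] in \<open>auto simp: D_def\<close>)
    moreover have "\<exists>n b. D n \<subseteq> mcball b e" if "e > 0" for e
    proof -
      obtain n where n: "inverse (Suc n) < e" using reals_Archimedean[OF \<open>e > 0\<close>] by auto
      have "D n \<subseteq> mcball (a (map z [0..<n])) e"
        unfolding D_def C_def using small[of "map z [0..<n]"] n
        by (intro mcball_subset_concentric) auto
      then show ?thesis by blast
    qed
    ultimately have "\<Inter> (range D) \<noteq> {}" using \<open>mcomplete\<close> unfolding mcomplete_nest by blast
    then show ?thesis by (auto simp: D_def)
  qed
  then obtain l where l: "\<And>z n. l z \<in> C (map z [0..<n])" by metis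
  define p where "p t = (case t of FinSeq s \<Rightarrow> x s | InfSeq z \<Rightarrow> l z)" for t
  have p_simps: "p (FinSeq s) = x s" "p (InfSeq z) = l z" for s z by (auto simp: p_def)
  have in_B: "p t \<in> B s" if "t \<in> N_star s" for s t
  proof (cases t)
    case (FinSeq u)
    then obtain v where u: "u = s @ v" using \<open>t \<in> N_star s\<close> by (auto simp: prefix_def)
    show ?thesis
    proof (cases v)
      case Nil
      then show ?thesis using u FinSeq point by (simp add: p_simps)
    next
      case (Cons k w)
      then have "x u \<in> C (s @ [k])" using u point[of u] BC[of u] C_append[of "s @ [k]" w] by auto
      then show ?thesis using nested FinSeq by (auto simp: p_simps)
    qed
  next
    case (InfSeq z)
    then have "map z [0..<Suc (length s)] = s @ [z (length s)]" using that by (simp add: InfSeq_in_N_star)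
    then show ?thesis using l[of z "Suc (length s)"] nested[of s "z (length s)"] InfSeq
      by (auto simp: p_simps)
  qed
  have notin_C: "p t \<notin> C s" if "t \<notin> N_star s" for s t
  proof (cases t)
    case (FinSeq u)
    have xu: "x u \<in> C u" using point BC by blast
    show ?thesis
    \<comment> \<open>Either \<open>u\<close> is a proper prefix of \<open>s\<close>, or \<open>u\<close> and \<open>s\<close> already differ at their common length.\<close>
    proof (cases "take (length u) s = u")
      case True
      with that FinSeq obtain k w where s: "s = u @ [k] @ w"
        by (metis FinSeq_in_N_star append.simps append_take_drop_id prefix_order.refl append_Nil2 neq_Nil_conv)
      then show ?thesis using avoid[of u k] C_append[of "u @ [k]" w] FinSeq by (auto simp: p_simps)
    next
      case False
      define m where "m = min (length u) (length s)"
      have "take m u \<noteq> take m s"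
        using False that FinSeq unfolding m_def min_def
        by (metis FinSeq_in_N_star nle_le take_all take_is_prefix)
      moreover have "length (take m u) = length (take m s)" by (simp add: m_def)
      ultimately have "disjnt (C (take m u)) (C (take m s))" using C_parallel by blast
      moreover have "C s \<subseteq> C (take m s)" "C u \<subseteq> C (take m u)"
        by (metis C_append append_take_drop_id)+
      ultimately show ?thesis using xu FinSeq by (auto simp: p_simps disjnt_def)
    qed
  next
    case (InfSeq z)
    then have "disjnt (C (map z [0..<length s])) (C s)"
      using that by (intro C_parallel) (auto simp: InfSeq_in_N_star)
    then show ?thesis using l[of z "length s"] InfSeq by (auto simp: p_simps disjnt_def)
  qed
  have B_vimage: "p -` B s = N_star s" and C_vimage: "p -` C s = N_star s" for s
    using in_B notin_C BC by blast+
  have top: "p t \<in> M" for t using in_B[of t "[]"] by (auto simp: B_def)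
  have "continuous_map nat_seq_topology mtopology p"
    unfolding continuous_map_def
  proof (intro conjI allI impI)
    fix U assume U: "openin mtopology U"
    have "\<exists>T. openin nat_seq_topology T \<and> t \<in> T \<and> T \<subseteq> p -` U" if "p t \<in> U" for t
    proof -
      obtain e where e: "e > 0" "mball (p t) e \<subseteq> U" using U \<open>p t \<in> U\<close> unfolding openin_mtopology by blast
      show ?thesis
      proof (cases t)
        case (FinSeq s)
        obtain K where K: "inverse (Suc K) < e" using reals_Archimedean[OF e(1)] by auto
        define T where "T = N_star s - (\<Union>k<K. N_star (s @ [k]))"
        have "openin nat_seq_topology T" unfolding T_def
          by (intro openin_diff N_star_clopen closedin_Union) (auto simp: N_star_clopen)
        moreover have "t \<in> T" using FinSeq by (auto simp: T_def)
        moreover have "p u \<in> U" if u: "u \<in> T" for u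
        proof (cases "u = t")
          case False
          then obtain k where k: "u \<in> N_star (s @ [k])"
            using u FinSeq N_star_snoc_cases unfolding T_def by (metis DiffD1)
          then have "K \<le> k" using u by (auto simp: T_def not_less[symmetric])
          then have "inverse (real (Suc k)) \<le> inverse (Suc K)" by (simp add: field_simps)
          moreover have pu: "p u \<in> mball (x s) (inverse (Suc k))" using in_B[OF k] BC conv by blast
          ultimately have "d (x s) (p u) < e" using K unfolding in_mball by linarith
          then have "p u \<in> mball (p t) e" using pu FinSeq by (simp add: p_simps)
          then show ?thesis using e by blast
        qed (use \<open>p t \<in> U\<close> in simp)
        ultimately show ?thesis by blast
      next
        case (InfSeq z)
        have "e / 2 > 0" using e by simp
        then obtain n where n: "inverse (Suc n) < e / 2" using reals_Archimedean by blast
        define s where "s = map z [0..<n]"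
        have t: "t \<in> N_star s" using InfSeq InfSeq_in_N_star_restrict s_def by simp
        have "p u \<in> U" if "u \<in> N_star s" for u
        proof -
          have "d (a s) (p u) < r s" "d (a s) (p t) < r s" "a s \<in> M"
            using in_B[OF t] in_B[OF that] by (auto simp: B_def)
          moreover have "d (p t) (p u) \<le> d (a s) (p t) + d (a s) (p u)"
            using triangle commute top \<open>a s \<in> M\<close> by metis
          moreover have "r s < e / 2" using small[of s] n by (simp add: s_def)
          ultimately have "p u \<in> mball (p t) e" using top by auto
          then show ?thesis using e by blast
        qed
        then show ?thesis using t N_star_clopen by blast
      qed
    qed
    then have "openin nat_seq_topology (p -` U)" by (subst openin_subopen) auto
    moreover have "{t \<in> topspace nat_seq_topology. p t \<in> U} = p -` U" by auto
    ultimately show "openin nat_seq_topology {t \<in> topspace nat_seq_topology. p t \<in> U}" by simp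
  qed (use top in auto)
  then have "embedding_map nat_seq_topology mtopology p"
  proof (rule embedding_map_nat_seqI)
    show "\<exists>V. openin mtopology V \<and> p -` V = N_star s" for s
      using B_vimage openin_mball unfolding B_def by blast
    show "\<exists>D. closedin mtopology D \<and> p -` D = N_star s" for s
      using C_vimage[of s] closedin_mcball[of "a s" "r s"] unfolding C_def by blast
  qed
  then show ?thesis using that p_simps l unfolding C_def by metis
qed

section \<open>Localising the failure to be a countable union of closed sets\<close>

lemma (in Metric_space) second_countable_mtopology:
  assumes "separable_space mtopology"
  shows "second_countable mtopology"
proof -
  obtain D where D: "countable D" "D \<subseteq> M" "mtopology closure_of D = M"
    using assms by (auto simp: separable_space_def)
  define \<B> where "\<B> = (\<lambda>(c, n::nat). mball c (inverse (Suc n))) ` (D \<times> UNIV)"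
  have "\<exists>V\<in>\<B>. x \<in> V \<and> V \<subseteq> U" if U: "openin mtopology U" "x \<in> U" for U x
  proof -
    obtain e where e: "e > 0" "mball x e \<subseteq> U" "x \<in> M" using U unfolding openin_mtopology by blast
    then have "e / 2 > 0" by simp
    then obtain n where n: "inverse (Suc n) < e / 2" using reals_Archimedean by blast
    obtain c where c: "c \<in> D" "c \<in> mball x (inverse (Suc n))"
    proof -
      have "x \<in> mtopology closure_of D" using D(3) \<open>x \<in> M\<close> by simp
      then have "\<exists>c\<in>D. c \<in> mball x (inverse (Suc n))"
        unfolding metric_closure_of using inverse_Suc by blast
      then show ?thesis using that by blast
    qed
    have "mball c (inverse (Suc n)) \<subseteq> mball x e"
      using c n by (intro mball_subset) (auto simp: commute)
    moreover have "x \<in> mball c (inverse (Suc n))" using c by (auto simp: commute)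
    ultimately show ?thesis using c e unfolding \<B>_def by blast
  qed
  moreover have "countable \<B>" unfolding \<B>_def using D(1) by blast
  moreover have "\<forall>V\<in>\<B>. openin mtopology V" by (auto simp: \<B>_def)
  ultimately show ?thesis unfolding second_countable_def by blast
qed

lemma fsigma_in_Int_Union_open:
  assumes "second_countable X"
    and "\<And>U. U \<in> \<U> \<Longrightarrow> openin X U" "\<And>U. U \<in> \<U> \<Longrightarrow> fsigma_in X (A \<inter> U)"
  shows "fsigma_in X (A \<inter> \<Union>\<U>)"
proof -
  have sub: "\<Union>\<U> \<subseteq> topspace X"
    using assms(2) by (intro Union_least openin_subset)
  have "Lindelof_space (subtopology X (\<Union>\<U>))"
    using assms(1) by (simp add: second_countable_imp_Lindelof_space second_countable_subtopology)
  then have "(\<forall>U\<in>\<U>. openin X U) \<and> \<Union>\<U> \<subseteq> \<Union>\<U> \<longrightarrow>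
      (\<exists>\<V>. countable \<V> \<and> \<V> \<subseteq> \<U> \<and> \<Union>\<U> \<subseteq> \<Union>\<V>)"
    unfolding Lindelof_space_subtopology_subset[OF sub] by (rule spec)
  then obtain \<V> where V: "countable \<V>" "\<V> \<subseteq> \<U>" "\<Union>\<U> \<subseteq> \<Union>\<V>"
    using assms(2) by auto
  have "\<Union>\<U> = \<Union>\<V>" using V(2,3) by (simp add: Union_mono subset_antisym)
  then have "A \<inter> \<Union>\<U> = \<Union> ((\<inter>) A ` \<V>)" by (metis Int_Union)
  moreover have "fsigma_in X (\<Union> ((\<inter>) A ` \<V>))"
  proof (rule fsigma_in_Union)
    show "countable ((\<inter>) A ` \<V>)" using V(1) by simp
    fix S assume "S \<in> (\<inter>) A ` \<V>"
    then obtain U where "U \<in> \<V>" "S = A \<inter> U" by (rule imageE)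
    then show "fsigma_in X S" using V(2) assms(3) by auto
  qed
  ultimately show ?thesis by simp
qed

text \<open>
  \<open>F\<close> is the complement of the union \<open>W\<close> of all open sets on which \<open>A\<close> is \<open>F\<^sub>\<sigma>\<close>. By the Lindelof
  property \<open>A\<close> is \<open>F\<^sub>\<sigma>\<close> on \<open>W\<close> as well. So if \<open>A \<inter> U \<inter> F\<close> were \<open>F\<^sub>\<sigma>\<close>, then so would be \<open>A \<inter> U\<close>,
  and \<open>U\<close> would have been discarded.
\<close>
lemma nowhere_fsigma_kernel:
  assumes X: "metrizable_space X" "second_countable X"
    and A: "A \<subseteq> topspace X" "\<not> fsigma_in X A"
  obtains F where "closedin X F" "F \<noteq> {}"
    and "\<And>U. openin X U \<Longrightarrow> U \<inter> F \<noteq> {} \<Longrightarrow> \<not> fsigma_in X (A \<inter> U \<inter> F)"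
proof
  define \<U> where "\<U> = {U. openin X U \<and> fsigma_in X (A \<inter> U)}"
  let ?F = "topspace X - \<Union>\<U>"
  have small: "fsigma_in X (A \<inter> \<Union>\<U>)"
    using X(2) by (rule fsigma_in_Int_Union_open) (auto simp: \<U>_def)
  have opn: "openin X (\<Union>\<U>)" by (auto simp: \<U>_def)
  then show "closedin X ?F" by blast
  show "?F \<noteq> {}"
    using small A openin_subset[OF opn] by (metis Diff_eq_empty_iff inf.orderE subset_antisym)
  fix U assume U: "openin X U" "U \<inter> ?F \<noteq> {}"
  show "\<not> fsigma_in X (A \<inter> U \<inter> ?F)"
  proof
    assume "fsigma_in X (A \<inter> U \<inter> ?F)"
    moreover have "fsigma_in X (A \<inter> \<Union>\<U> \<inter> U)"
      using small open_imp_fsigma_in[OF X(1) U(1)] by (rule fsigma_in_Int)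
    ultimately have "fsigma_in X ((A \<inter> U \<inter> ?F) \<union> (A \<inter> \<Union>\<U> \<inter> U))" by (rule fsigma_in_Un)
    moreover have "(A \<inter> U \<inter> ?F) \<union> (A \<inter> \<Union>\<U> \<inter> U) = A \<inter> U" using A by blast
    ultimately have "U \<in> \<U>" using U by (simp add: \<U>_def)
    then show False using U by blast
  qed
qed

section \<open>Constructing the scheme\<close>

text \<open>
  In the application \<open>h q\<close> is the distance of \<open>f q\<close> from \<open>y\<close>, and the sets \<open>G n\<close> intersect in the fibre
  of \<open>y\<close>. The two density hypotheses alternate: the first supplies the centre of a ball, the
  second its marked point. A successor ball of \<open>t\<close> can be centred in the fibre, arbitrarily close
  to the marked point of \<open>t\<close> but distinct from it, since \<open>h\<close> is positive there.

  The recursion runs along an enumeration of the finite sequences rather than along the tree, since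
  the requirement that \<open>h\<close> decrease strictly, which makes \<open>h \<circ> x\<close> injective, refers to all marked
  points chosen earlier.
\<close>
lemma (in Metric_space) ball_scheme_exists:
  fixes h :: "'a \<Rightarrow> real" and G :: "nat \<Rightarrow> 'a set"
  assumes F: "F \<subseteq> M" "F \<noteq> {}"
    and G: "\<And>n. openin mtopology (G n)"
    and dense_zero: "\<And>U. openin mtopology U \<Longrightarrow> U \<inter> F \<noteq> {} \<Longrightarrow> U \<inter> F \<inter> (\<Inter>n. G n) \<noteq> {}"
    and zero: "\<And>q. q \<in> (\<Inter>n. G n) \<Longrightarrow> h q = 0"
    and dense_pos: "\<And>U e. openin mtopology U \<Longrightarrow> U \<inter> F \<noteq> {} \<Longrightarrow> e > 0 \<Longrightarrow>
      \<exists>q\<in>U \<inter> F. 0 < h q \<and> h q < e"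
  obtains a r x where "ball_scheme a r x"
    and "\<And>s k. mcball (a (s @ [k])) (r (s @ [k])) \<subseteq> G (length s)"
    and "\<And>s. h (x s) > 0" "inj (\<lambda>s. h (x s))"
    and "\<And>e. e > 0 \<Longrightarrow> finite {s. h (x s) \<ge> e}"
proof -
  \<comment> \<open>\<^const>\<open>list_encode\<close> increases when an element is added in front; reversing makes every
    sequence precede its one-step extensions.\<close>
  define code where "code s = list_encode (rev s)" for s
  have code_inj: "code s = code t \<longleftrightarrow> s = t" for s t
    unfolding code_def by (metis list_encode_inverse rev_rev_ident)
  have code_less: "code s < code (s @ [k])" for s k
    by (simp add: code_def le_imp_less_Suc le_prod_encode_2)
  have fin_code: "finite {t. code t < n}" for n
  proof (rule finite_imageD)
    show "finite (code ` {t. code t < n})" by (rule finite_subset[of _ "{..<n}"]) auto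
    show "inj_on code {t. code t < n}" by (auto simp: inj_on_def code_inj)
  qed
  \<comment> \<open>\<open>P f s (a, r, x)\<close>: ball and marked point are admissible at \<open>s\<close>, given the choices \<open>f\<close> for
    smaller codes. Disjointness is demanded from siblings of smaller code only; by symmetry that
    covers all pairs.\<close>
  define P where "P f s y \<longleftrightarrow> (case y of (a, r, x) \<Rightarrow>
      r \<le> inverse (Suc (length s)) \<and> x \<in> mball a r \<and> x \<in> F \<and> 0 < h x \<and> h x < inverse (Suc (code s)) \<and>
      (\<forall>t. code t < code s \<longrightarrow> h x < h (snd (snd (f t)))) \<and>
      (\<forall>t k. s = t @ [k] \<longrightarrow> (case f t of (a', r', x') \<Rightarrow>
         mcball a r \<subseteq> mball a' r' \<inter> mball x' (inverse (Suc k)) \<inter> G (length t) - {x'}) \<and>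
         (\<forall>j. code (t @ [j]) < code s \<longrightarrow> (case f (t @ [j]) of (b, q, _) \<Rightarrow> disjnt (mcball b q) (mcball a r)))))"
    for f :: "nat list \<Rightarrow> 'a \<times> real \<times> 'a" and s y
  have "\<exists>f. \<forall>s. P f s (f s)"
  proof (rule dependent_wf_choice)
    show "wf (Wellfounded.measure code)" by simp
  next
    fix f g :: "nat list \<Rightarrow> 'a \<times> real \<times> 'a" and s y
    assume "\<And>t. (t, s) \<in> Wellfounded.measure code \<Longrightarrow> f t = g t"
    then have eq: "f t = g t" if "code t < code s" for t using that by simp
    show "P f s y = P g s y"
      unfolding P_def using eq code_less by (auto split: prod.splits)
  next
    fix s and f :: "nat list \<Rightarrow> 'a \<times> real \<times> 'a"
    assume "\<And>t. (t, s) \<in> Wellfounded.measure code \<Longrightarrow> P f t (f t)"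
    then have IH: "P f t (f t)" if "code t < code s" for t using that by simp
    have "\<exists>a r. (mball a r \<inter> F \<noteq> {}) \<and> r \<le> inverse (Suc (length s)) \<and>
      (\<forall>t k. s = t @ [k] \<longrightarrow> (case f t of (a', r', x') \<Rightarrow>
         mcball a r \<subseteq> mball a' r' \<inter> mball x' (inverse (Suc k)) \<inter> G (length t) - {x'}) \<and>
         (\<forall>j. code (t @ [j]) < code s \<longrightarrow> (case f (t @ [j]) of (b, q, _) \<Rightarrow> disjnt (mcball b q) (mcball a r))))"
    proof (cases s rule: rev_cases)
      case Nil
      obtain q where "q \<in> F" using F by blast
      then have "q \<in> mball q 1 \<inter> F" using F by auto
      then have "mball q 1 \<inter> F \<noteq> {}" by blast
      then show ?thesis using Nil by (intro exI[of _ q] exI[of _ 1]) simp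
    next
      case (snoc t k)
      obtain a' r' x' where ft: "f t = (a', r', x')" by (cases "f t")
      have x': "x' \<in> mball a' r'" "x' \<in> F" "h x' > 0"
        using IH[of t] code_less snoc ft by (auto simp: P_def)
      \<comment> \<open>The finitely many siblings treated so far stay away from \<open>x'\<close>, so removing them leaves
        a neighbourhood of \<open>x'\<close>.\<close>
      define S where "S = {u. (\<exists>j. u = t @ [j]) \<and> code u < code s}"
      define W where "W = mball a' r' \<inter> mball x' (inverse (Suc k)) -
        (\<Union>u\<in>S. case f u of (b, q, _) \<Rightarrow> mcball b q)"
      have "finite S" unfolding S_def by (rule finite_subset[OF _ fin_code[of "code s"]]) auto
      then have W: "openin mtopology W" unfolding W_def
        by (intro openin_diff openin_Int closedin_Union) (auto split: prod.splits)
      have "x' \<notin> (case f u of (b, q, _) \<Rightarrow> mcball b q)" if "u \<in> S" for u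
        using IH[of u] that ft by (auto simp: P_def S_def split: prod.splits)
      then have "x' \<in> W \<inter> F" using x' F by (auto simp: W_def)
      then obtain a where a: "a \<in> W" "a \<in> F" "a \<in> (\<Inter>n. G n)" using dense_zero[OF W] by blast
      then have "a \<noteq> x'" using zero x' by force
      moreover have "openin mtopology (W \<inter> G (length t) - {x'})"
        using W G x' F by (intro openin_diff openin_Int closedin_Hausdorff_singleton) (auto simp: Hausdorff_space_mtopology)
      ultimately obtain r where r: "r > 0" "mcball a r \<subseteq> W \<inter> G (length t) - {x'}"
        using a unfolding openin_mtopology_mcball by blast
      define r1 where "r1 = min r (inverse (Suc (length s)))"
      have r1: "r1 > 0" "r1 \<le> inverse (Suc (length s))" using r by (auto simp: r1_def)
      have sub: "mcball a r1 \<subseteq> W \<inter> G (length t) - {x'}"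
        using r(2) mcball_subset_concentric[of r1 r a] by (auto simp: r1_def)
      have "mball a r1 \<inter> F \<noteq> {}" using a r1 F by auto
      moreover have "disjnt (mcball b q) (mcball a r1)"
        if "code (t @ [j]) < code s" "f (t @ [j]) = (b, q, z)" for j b q z
      proof -
        have "t @ [j] \<in> S" using that by (auto simp: S_def)
        then have "mcball b q \<inter> W = {}" using that(2) unfolding W_def by force
        then show ?thesis using sub by (auto simp: disjnt_def)
      qed
      moreover have "mcball a r1 \<subseteq> mball a' r' \<inter> mball x' (inverse (Suc k)) \<inter> G (length t) - {x'}"
        using sub unfolding W_def by blast
      ultimately show ?thesis using snoc ft r1
        by (intro exI[of _ a] exI[of _ r1]) (auto split: prod.splits)
    qed
    then obtain a r where ar: "mball a r \<inter> F \<noteq> {}" "r \<le> inverse (Suc (length s))"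
      "\<And>t k. s = t @ [k] \<Longrightarrow> (case f t of (a', r', x') \<Rightarrow>
         mcball a r \<subseteq> mball a' r' \<inter> mball x' (inverse (Suc k)) \<inter> G (length t) - {x'}) \<and>
         (\<forall>j. code (t @ [j]) < code s \<longrightarrow> (case f (t @ [j]) of (b, q, _) \<Rightarrow> disjnt (mcball b q) (mcball a r)))"
      by blast
    \<comment> \<open>The finitely many upper bounds for \<open>h x\<close>, all positive.\<close>
    define E where "E = insert (inverse (Suc (code s))) ((\<lambda>t. h (snd (snd (f t)))) ` {t. code t < code s})"
    have E: "finite E" "E \<noteq> {}" using fin_code by (auto simp: E_def)
    moreover have "h (snd (snd (f t))) > 0" if "code t < code s" for t
      using IH[OF that] by (auto simp: P_def)
    ultimately have "Min E > 0" by (auto simp: E_def)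
    then obtain x where x: "x \<in> mball a r" "x \<in> F" "0 < h x" "h x < Min E"
      using dense_pos[OF openin_mball ar(1)] by blast
    then have "h x < e" if "e \<in> E" for e using E that by (meson Min_le less_le_trans)
    then have "h x < inverse (Suc (code s))" "\<And>t. code t < code s \<Longrightarrow> h x < h (snd (snd (f t)))"
      by (auto simp: E_def)
    then have "P f s (a, r, x)" unfolding P_def using x ar by auto
    then show "\<exists>y. P f s y" by blast
  qed
  then obtain f where f: "\<And>s. P f s (f s)" by blast
  define a where "a s = fst (f s)" for s
  define r where "r s = fst (snd (f s))" for s
  define x where "x s = snd (snd (f s))" for s
  have f_eq: "f s = (a s, r s, x s)" for s by (simp add: a_def r_def x_def)
  note all = f[unfolded P_def f_eq, simplified]
  show ?thesis
  proof
    show "h (x s) > 0" for s using all[of s] by auto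
    show "mcball (a (s @ [k])) (r (s @ [k])) \<subseteq> G (length s)" for s k
      using all[of "s @ [k]"] by auto
    have *: "disjnt (mcball (a (s @ [j])) (r (s @ [j]))) (mcball (a (s @ [k])) (r (s @ [k])))"
      if "code (s @ [j]) < code (s @ [k])" for s j k
      using all[of "s @ [k]"] that by auto
    show "ball_scheme a r x"
      unfolding ball_scheme_def
    proof (intro conjI allI impI)
      show "x s \<in> mball (a s) (r s)" "r s \<le> inverse (Suc (length s))" for s
        using all[of s] by auto
      show "mcball (a (s @ [k])) (r (s @ [k]))
          \<subseteq> mball (a s) (r s) \<inter> mball (x s) (inverse (Suc k)) - {x s}" for s k
        using all[of "s @ [k]"] by auto
      show "disjnt (mcball (a (s @ [j])) (r (s @ [j]))) (mcball (a (s @ [k])) (r (s @ [k])))"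
        if "j \<noteq> k" for s j k
      proof -
        have "code (s @ [j]) \<noteq> code (s @ [k])" using that by (simp add: code_inj)
        then show ?thesis using * disjnt_sym by (metis linorder_neqE_nat)
      qed
    qed
    have mono: "h (x s) < h (x t)" if "code t < code s" for s t using all[of s] that by auto
    show "inj (\<lambda>s. h (x s))"
      by (rule injI) (metis mono code_inj less_irrefl linorder_neqE_nat)
    show "finite {s. h (x s) \<ge> e}" if "e > 0" for e
    proof -
      obtain n where n: "inverse (Suc n) < e" using reals_Archimedean[OF \<open>e > 0\<close>] by auto
      have "code s < n" if "h (x s) \<ge> e" for s
      proof (rule ccontr)
        assume "\<not> code s < n"
        then have "inverse (real (Suc (code s))) \<le> inverse (Suc n)" by (simp add: field_simps)
        moreover have "h (x s) < inverse (Suc (code s))" using all[of s] by auto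
        ultimately show False using that n by linarith
      qed
      then show ?thesis by (intro finite_subset[OF _ fin_code[of n]]) auto
    qed
  qed
qed

section \<open>Embedding at a fibre and the dichotomy\<close>

lemma embedding_imp_continuous_map:
  assumes "embedding_map X Y f"
  shows "continuous_map X Y f"
  using homeomorphic_imp_continuous_map[OF assms[unfolded embedding_map_def]]
  by (simp add: continuous_map_in_subtopology)

text \<open>
  The part of the existence argument in which \<open>f\<^sub>0\<close> does not occur yet: a fibre that is not
  \<open>F\<^sub>\<sigma>\<close> already yields the embedding of the domain, with values off the fibre injective and
  convergent to \<open>y\<close>.
\<close>
lemma non_fsigma_fibre_embedding:
  assumes "Polish_space X" "Polish_space Y" and baire: "baire_class_one X Y f"
    and y: "y \<in> topspace Y" "\<not> fsigma_in X {x \<in> topspace X. f x = y}"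
  obtains p where "embedding_map nat_seq_topology X p"
    and "\<And>z. f (p (InfSeq z)) = y" and "\<And>s. f (p (FinSeq s)) \<noteq> y"
    and "inj (\<lambda>s. f (p (FinSeq s)))"
    and "\<And>V. openin Y V \<Longrightarrow> y \<in> V \<Longrightarrow> finite {s. f (p (FinSeq s)) \<notin> V}"
proof -
  have maps: "f \<in> topspace X \<rightarrow> topspace Y"
    and fsigma_vimage: "\<And>U. openin Y U \<Longrightarrow> fsigma_in X {x \<in> topspace X. f x \<in> U}"
    using baire by (auto simp: baire_class_one_def)
  obtain M d where Md: "Metric_space M d" "Metric_space.mcomplete M d" "X = Metric_space.mtopology M d"
    using \<open>Polish_space X\<close> unfolding Polish_space_def completely_metrizable_space_def by blast
  obtain M' d' where Md': "Metric_space M' d'" "Y = Metric_space.mtopology M' d'"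
    using \<open>Polish_space Y\<close> unfolding Polish_space_def completely_metrizable_space_def by blast
  interpret X: Metric_space M d by fact
  interpret Y: Metric_space M' d' by fact
  have topX: "topspace X = M" and topY: "topspace Y = M'" using Md Md' by auto
  have metX: "metrizable_space X" using Md X.metrizable_space_mtopology by simp
  have sc: "second_countable X"
    using X.second_countable_mtopology \<open>Polish_space X\<close> Md(3) by (simp add: Polish_space_def)
  define A where "A = {x \<in> topspace X. f x = y}"
  have A_sub: "A \<subseteq> topspace X" by (auto simp: A_def)
  define h where "h x = d' (f x) y" for x
  have h_zero: "h x = 0 \<longleftrightarrow> f x = y" if "x \<in> M" for x
  proof -
    have "f x \<in> M'" "y \<in> M'" using that maps y unfolding topX topY by blast+
    then show ?thesis by (simp add: h_def)
  qed
  have h_pos: "h x \<ge> 0" for x by (simp add: h_def)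
  obtain F where F: "closedin X F" "F \<noteq> {}"
    "\<And>U. openin X U \<Longrightarrow> U \<inter> F \<noteq> {} \<Longrightarrow> \<not> fsigma_in X (A \<inter> U \<inter> F)"
    using nowhere_fsigma_kernel[OF metX sc A_sub] y(2) unfolding A_def by metis
  have FM: "F \<subseteq> M" using F(1) closedin_subset topX by blast
  have "openin Y (topspace Y - {y})"
    using y Md'(2) by (intro openin_diff) (auto intro!: closedin_Hausdorff_singleton Y.Hausdorff_space_mtopology)
  then obtain C where C: "\<And>n::nat. closedin X (C n)"
    "\<Union> (range C) = {x \<in> topspace X. f x \<in> topspace Y - {y}}"
    using fsigma_vimage unfolding fsigma_in_ascending by metis
  define G where "G n = topspace X - C n" for n
  have G: "openin X (G n)" for n using C(1) by (simp add: G_def openin_diff)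
  have AG: "(\<Inter>n. G n) = A" using C(2) maps unfolding G_def A_def by blast
  \<comment> \<open>Without such a \<open>q\<close>, the part of the fibre in \<open>U \<inter> F\<close> would agree with the part of the
    preimage of a ball, which is \<open>F\<^sub>\<sigma>\<close>.\<close>
  have dense_pos: "\<exists>q\<in>U \<inter> F. 0 < h q \<and> h q < e" if U: "openin X U" "U \<inter> F \<noteq> {}" and "e > 0" for U e
  proof (rule ccontr)
    assume no: "\<not> (\<exists>q\<in>U \<inter> F. 0 < h q \<and> h q < e)"
    let ?B = "{x \<in> topspace X. f x \<in> Y.mball y e}"
    have "?B \<inter> U \<inter> F = A \<inter> U \<inter> F"
    proof -
      have "x \<in> ?B \<longleftrightarrow> x \<in> A" if "x \<in> U \<inter> F" for x
      proof -
        have "x \<in> M" "f x \<in> M'" using that FM maps topX topY by auto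
        then show ?thesis
          using no that h_zero[of x] h_pos[of x] y \<open>e > 0\<close>
          by (auto simp: A_def h_def topX topY Y.commute less_le)
      qed
      then show ?thesis by blast
    qed
    moreover have "fsigma_in X (?B \<inter> U \<inter> F)"
      using fsigma_vimage[of "Y.mball y e"] Md'(2) open_imp_fsigma_in[OF metX U(1)] closed_imp_fsigma_in[OF F(1)]
      by (simp add: fsigma_in_Int)
    ultimately show False using F(3)[OF U] by simp
  qed
  have dense_zero: "U \<inter> F \<inter> (\<Inter>n. G n) \<noteq> {}" if "openin X U" "U \<inter> F \<noteq> {}" for U
  proof -
    have "A \<inter> U \<inter> F \<noteq> {}" using F(3)[OF that] fsigma_in_empty[of X] by auto
    then show ?thesis unfolding AG by blast
  qed
  have zero: "h q = 0" if "q \<in> (\<Inter>n. G n)" for q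
    using that h_zero A_sub topX unfolding AG A_def by blast
  obtain a r x where scheme: "X.ball_scheme a r x"
    and scheme_G: "\<And>s k. X.mcball (a (s @ [k])) (r (s @ [k])) \<subseteq> G (length s)"
    and hx: "\<And>s. h (x s) > 0" "inj (\<lambda>s. h (x s))" "\<And>e. e > 0 \<Longrightarrow> finite {s. h (x s) \<ge> e}"
    using X.ball_scheme_exists[OF FM F(2) G[unfolded Md(3)] dense_zero[unfolded Md(3)] zero
      dense_pos[unfolded Md(3)]] by blast
  obtain p where p: "embedding_map nat_seq_topology X p" "\<And>s. p (FinSeq s) = x s"
    "\<And>z n. p (InfSeq z) \<in> X.mcball (a (map z [0..<n])) (r (map z [0..<n]))"
    using X.embedding_of_ball_scheme[OF Md(2) scheme] unfolding Md(3) by blast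
  have p_top: "p t \<in> M" for t
    using embedding_imp_continuous_map[OF p(1)] topX by (auto simp: continuous_map_def)
  have "p (InfSeq z) \<in> G n" for z n
    using p(3)[of z "Suc n"] scheme_G[of "map z [0..<n]" "z n"] by auto
  then have f_inf: "f (p (InfSeq z)) = y" for z
    using AG unfolding A_def by blast
  have f_fin: "f (p (FinSeq s)) \<noteq> y" for s
    using hx(1)[of s] h_zero[OF p_top[of "FinSeq s"]] p(2) by auto
  have inj: "inj (\<lambda>s. f (p (FinSeq s)))"
    using hx(2) p(2) by (auto simp: inj_def h_def)
  have "finite {s. f (p (FinSeq s)) \<notin> V}" if V: "openin Y V" "y \<in> V" for V
  proof -
    obtain e where e: "e > 0" "Y.mball y e \<subseteq> V"
      using V unfolding Md'(2) Y.openin_mtopology by blast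
    have "h (x s) \<ge> e" if "f (p (FinSeq s)) \<notin> V" for s
    proof -
      have "f (x s) \<notin> Y.mball y e" using that e p(2) by auto
      moreover have "f (x s) \<in> M'" "y \<in> M'"
        using p_top[of "FinSeq s"] p(2) maps y(1) unfolding topX[symmetric] topY[symmetric] by auto
      ultimately show ?thesis by (simp add: h_def Y.commute)
    qed
    then show ?thesis by (intro finite_subset[OF _ hx(3)[OF e(1)]]) blast
  qed
  with p(1) f_inf f_fin inj show ?thesis by (rule that)
qed

theorem theorem1:
  fixes X :: "'a topology" and Y :: "'b topology" and f :: "'a \<Rightarrow> 'b"
    and f0 :: "nat_seq \<Rightarrow> real"
  assumes f0_infinite: "\<And>x. f0 (InfSeq x) = 0"
    and f0_inj: "inj (\<lambda>s. f0 (FinSeq s))"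
    and f0_finite: "range (\<lambda>s. f0 (FinSeq s)) \<subseteq> {1 / real n |n. n \<ge> 1}"
    and "Polish_space X" and "Polish_space Y"
    and "baire_class_one X Y f"
  shows "(fsigma_to_one X Y f \<or>
          (\<exists>\<pi>X \<pi>Y. function_embedding nat_seq_topology euclideanreal f0 X Y f \<pi>X \<pi>Y)) \<and>
         \<not> (fsigma_to_one X Y f \<and>
            (\<exists>\<pi>X \<pi>Y. function_embedding nat_seq_topology euclideanreal f0 X Y f \<pi>X \<pi>Y))"
proof (intro conjI)
  have f0_pos: "f0 (FinSeq s) > 0" for s
  proof -
    have "f0 (FinSeq s) \<in> {1 / real n |n. n \<ge> 1}" using f0_finite by blast
    then show ?thesis by auto
  qed
  have f0_cases: "f0 t = f0 t' \<longleftrightarrow> t = t' \<or> (t \<in> range InfSeq \<and> t' \<in> range InfSeq)" for t t'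
  proof -
    have "f0 (FinSeq s) \<noteq> 0" "0 \<noteq> f0 (FinSeq s)" for s
      using f0_pos[of s] by auto
    moreover have "f0 (FinSeq s) = f0 (FinSeq s') \<longleftrightarrow> s = s'" for s s'
      using injD[OF f0_inj] by blast
    ultimately show ?thesis by (cases t; cases t') (auto simp: f0_infinite)
  qed
  have maps: "f \<in> topspace X \<rightarrow> topspace Y"
    using \<open>baire_class_one X Y f\<close> by (auto simp: baire_class_one_def)
  show "\<not> (fsigma_to_one X Y f \<and>
            (\<exists>\<pi>X \<pi>Y. function_embedding nat_seq_topology euclideanreal f0 X Y f \<pi>X \<pi>Y))"
  proof clarify
    fix pX pY
    assume F: "fsigma_to_one X Y f" and "function_embedding nat_seq_topology euclideanreal f0 X Y f pX pY"
    then have emb: "embedding_map nat_seq_topology X pX"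
      and embY: "embedding_map (subtopology euclideanreal (range f0)) (subtopology Y (f ` topspace X)) pY"
      and comm: "\<And>t. f (pX t) = pY (f0 t)" by (auto simp: function_embedding_def)
    have cont: "continuous_map nat_seq_topology X pX" using emb by (rule embedding_imp_continuous_map)
    then have top: "pX t \<in> topspace X" for t by (auto simp: continuous_map_def)
    have "inj_on pY (range f0)" using embY by (simp add: embedding_map_def homeomorphic_map_def)
    then have "f (pX t) = f (pX (InfSeq (\<lambda>_. 0))) \<longleftrightarrow> t \<in> range InfSeq" for t
      using f0_cases[of t "InfSeq (\<lambda>_. 0)"] by (auto simp: comm inj_on_eq_iff)
    then have eq: "range InfSeq = {t. f (pX t) = f (pX (InfSeq (\<lambda>_. 0)))}" by blast
    have "fsigma_in X {x \<in> topspace X. f x = f (pX (InfSeq (\<lambda>_. 0)))}"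
      using F top maps unfolding fsigma_to_one_def by blast
    then obtain C where C: "\<And>n::nat. closedin X (C n)"
      "\<Union> (range C) = {x \<in> topspace X. f x = f (pX (InfSeq (\<lambda>_. 0)))}"
      unfolding fsigma_in_ascending by metis
    have "closedin nat_seq_topology (pX -` C n)" for n
      using closedin_continuous_map_preimage[OF cont C(1)[of n]] by (simp add: vimage_def)
    then have "fsigma_in nat_seq_topology (\<Union> (range (\<lambda>n. pX -` C n)))"
      by (intro fsigma_in_Union) (auto intro: closed_imp_fsigma_in)
    moreover have "\<Union> (range (\<lambda>n. pX -` C n)) = range InfSeq"
      using C(2) top unfolding eq by blast
    ultimately show False using not_fsigma_in_range_InfSeq by simp
  qed
  show "fsigma_to_one X Y f \<or>
          (\<exists>\<pi>X \<pi>Y. function_embedding nat_seq_topology euclideanreal f0 X Y f \<pi>X \<pi>Y)"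
  proof (cases "fsigma_to_one X Y f")
    case False
    then obtain y where y: "y \<in> topspace Y" "\<not> fsigma_in X {x \<in> topspace X. f x = y}"
      by (auto simp: fsigma_to_one_def)
    obtain p where p: "embedding_map nat_seq_topology X p"
      "\<And>z. f (p (InfSeq z)) = y" "\<And>s. f (p (FinSeq s)) \<noteq> y" "inj (\<lambda>s. f (p (FinSeq s)))"
      "\<And>V. openin Y V \<Longrightarrow> y \<in> V \<Longrightarrow> finite {s. f (p (FinSeq s)) \<notin> V}"
      using non_fsigma_fibre_embedding[OF \<open>Polish_space X\<close> \<open>Polish_space Y\<close> \<open>baire_class_one X Y f\<close> y]
      by blast
    have p_top: "p t \<in> topspace X" for t
      using embedding_imp_continuous_map[OF p(1)] by (auto simp: continuous_map_def)
    have f_cases: "f (p t) = f (p t') \<longleftrightarrow> f0 t = f0 t'" for t t'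
      unfolding f0_cases by (cases t; cases t') (auto simp: p(2,3) p(3)[symmetric] inj_eq[OF p(4)])
    \<comment> \<open>By \<open>f_cases\<close> the choice of a preimage under \<open>f0\<close> does not matter.\<close>
    define pY where "pY v = f (p (inv f0 v))" for v
    have pY: "pY (f0 t) = f (p t)" for t
      unfolding pY_def using f_cases by (simp add: f_inv_into_f)
    have "embedding_map (subtopology euclideanreal (range f0)) (subtopology Y (f ` topspace X)) pY"
    proof (rule embedding_map_convergent_set)
      show "Hausdorff_space (subtopology Y (f ` topspace X))"
        using \<open>Polish_space Y\<close>
        by (simp add: Polish_space_def Hausdorff_space_subtopology
            completely_metrizable_imp_metrizable_space metrizable_imp_Hausdorff_space)
      show "0 \<in> range f0" using f0_infinite by (metis rangeI)
      show "pY ` range f0 \<subseteq> topspace (subtopology Y (f ` topspace X))"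
        using pY p_top maps by auto
      show "inj_on pY (range f0)" using pY f_cases by (auto simp: inj_on_def)
      fix V :: "real set" assume "openin euclideanreal V" "0 \<in> V"
      then obtain e where e: "e > 0" "\<And>v. \<bar>v\<bar> < e \<Longrightarrow> v \<in> V"
        unfolding open_openin[symmetric] open_dist by (auto simp: dist_real_def)
      obtain N where N: "1 / e < real N" using reals_Archimedean2 by blast
      have "range f0 - V \<subseteq> (\<lambda>n. 1 / real n) ` {..N}"
      proof
        fix v assume v: "v \<in> range f0 - V"
        then obtain t where t: "v = f0 t" by blast
        have "v \<noteq> 0" "\<not> \<bar>v\<bar> < e" using v e by force+
        then obtain s where "v = f0 (FinSeq s)" using t f0_infinite by (cases t) auto
        then obtain n where n: "v = 1 / real n" "n \<ge> 1" using f0_finite by blast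
        then have "e \<le> 1 / real n" using \<open>\<not> \<bar>v\<bar> < e\<close> by simp
        then have "real n \<le> 1 / e" using n e(1) by (simp add: field_simps)
        then show "v \<in> (\<lambda>n. 1 / real n) ` {..N}" using n N by auto
      qed
      then show "finite (range f0 - V)" by (rule finite_subset) simp
    next
      fix V assume "openin (subtopology Y (f ` topspace X)) V" "pY 0 \<in> V"
      then obtain W where W: "openin Y W" "V = W \<inter> f ` topspace X" by (auto simp: openin_subtopology)
      have "pY 0 = y" using pY[of "InfSeq (\<lambda>_. 0)"] p(2) f0_infinite by simp
      then have "y \<in> W" using W \<open>pY 0 \<in> V\<close> by blast
      have "pY ` range f0 - V \<subseteq> (\<lambda>s. f (p (FinSeq s))) ` {s. f (p (FinSeq s)) \<notin> W}"
      proof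
        fix v assume "v \<in> pY ` range f0 - V"
        then obtain t where t: "v = f (p t)" "f (p t) \<notin> W" using p_top W(2) by (auto simp: pY)
        then show "v \<in> (\<lambda>s. f (p (FinSeq s))) ` {s. f (p (FinSeq s)) \<notin> W}"
          using p(2) \<open>y \<in> W\<close> by (cases t) auto
      qed
      then show "finite (pY ` range f0 - V)"
        by (rule finite_subset) (use p(5)[OF W(1) \<open>y \<in> W\<close>] in simp)
    qed simp_all
    then have "function_embedding nat_seq_topology euclideanreal f0 X Y f p pY"
      using p(1) pY by (simp add: function_embedding_def)
    then show ?thesis by blast
  qed simp
qed

end
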